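(* Let $ABC$ be a triangle with $\angle ABC=30^\circ$ and $\angle ACB=60^\circ$, and let $P$ be its incenter. Let the cevians through $P$ be $AD$, $BE$, $CF$ with $D$ on $BC$, $E$ on $CA$, $F$ on $AB$, and let $r_1,\dots,r_6$ be the inradii of triangles $PBD$, $PDC$, $PCE$, $PEA$, $PAF$, $PFB$, respectively. Then each of the following equations holds: $$\frac{2}{r_1^4}+\frac{8}{r_3^4}+\frac{6}{r_4^4}+\frac{5}{r_5^4}=\frac{14}{r_2^4}+\frac{20}{r_6^4},$$ $$\frac{3}{r_1^2}+\frac{3}{r_2^2}+\frac{3}{r_4^2}=\frac{3}{r_3^2}+\frac{2}{r_5^2}+\frac{3}{r_6^2},$$ $$\frac{2}{r_1}+\frac{2}{r_2}+\frac{1}{r_5}+\frac{1}{r_6}=\frac{3}{r_3}+\frac{2}{r_4},$$ $$3r_1+5r_3+55r_4+22r_6=4r_2+75r_5,$$ $$2r_1r_3+3r_2r_4+9r_5r_1+9r_6r_2=27r_3r_5+r_4r_6.$$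
   Context: For a point $P$ inside $\triangle ABC$, line $AP$ meets side $BC$ at $D$, line $BP$ meets side $CA$ at $E$, and line $CP$ meets side $AB$ at $F$. The three cevians divide $\triangle ABC$ into six smaller triangles, numbered 1 to 6 in the order $PBD$, $PDC$, $PCE$, $PEA$, $PAF$, $PFB$; $r_i$ is the inradius of the $i$-th triangle. *)

theory Defs
  imports "HOL-Analysis.Analysis"
begin

text \<open>Unoriented angle at the vertex \<open>B\<close>, with values in \<open>[0, pi]\<close>.\<close>

definition vertex_angle :: "real ^ 2 \<Rightarrow> real ^ 2 \<Rightarrow> real ^ 2 \<Rightarrow> real" where
  "vertex_angle A B C = arccos (((A - B) \<bullet> (C - B)) / (norm (A - B) * norm (C - B)))"

text \<open>
  A circle is tangent to a side if it meets the line carrying the side in exactly one point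
  and this point belongs to the side itself.  The last condition excludes the excircles,
  each of which touches two of the three lines outside the triangle.
\<close>

definition tangent_to_side :: "real ^ 2 \<Rightarrow> real \<Rightarrow> real ^ 2 \<Rightarrow> real ^ 2 \<Rightarrow> bool" where
  "tangent_to_side I r X Y \<longleftrightarrow>
     (\<exists>T \<in> closed_segment X Y. sphere I r \<inter> affine hull {X, Y} = {T})"

definition is_incircle :: "real ^ 2 \<Rightarrow> real ^ 2 \<Rightarrow> real ^ 2 \<Rightarrow> real ^ 2 \<Rightarrow> real \<Rightarrow> bool" where
  "is_incircle A B C I r \<longleftrightarrow>
     r > 0 \<and> tangent_to_side I r A B \<and> tangent_to_side I r B C \<and> tangent_to_side I r C A"

text \<open>
  The incircle of a non-degenerate triangle exists and is unique, so the descriptions below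
  are meaningful whenever \<open>A\<close>, \<open>B\<close>, \<open>C\<close> are not collinear.
\<close>

definition incenter :: "real ^ 2 \<Rightarrow> real ^ 2 \<Rightarrow> real ^ 2 \<Rightarrow> real ^ 2" where
  "incenter A B C = (THE I. \<exists>r. is_incircle A B C I r)"

definition inradius :: "real ^ 2 \<Rightarrow> real ^ 2 \<Rightarrow> real ^ 2 \<Rightarrow> real" where
  "inradius A B C = (THE r. \<exists>I. is_incircle A B C I r)"

end

theory Submission
  imports Defs
begin

text \<open>
  With \<open>a\<close>, \<open>b\<close>, \<open>c\<close> the side lengths, equality of the two tangent segments at each vertex
  shows that the incircle is unique, with radius \<open>2 * area / (a + b + c)\<close> and centre the point
  with barycentric weights \<open>a : b : c\<close>.  Hence \<open>D\<close> divides \<open>BC\<close> in the ratio \<open>c : b\<close>, and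
  the sides and area of \<open>PBD\<close>, and with them its inradius, are explicit in \<open>a\<close>, \<open>b\<close>, \<open>c\<close>;
  the other five triangles are the same case after permuting \<open>A\<close>, \<open>B\<close>, \<open>C\<close>.  Here
  \<open>(a, b, c) = (2 t, t, sqrt 3 * t)\<close>, and every ratio \<open>r\<^sub>i / t\<close> lies in the field generated by
  \<open>sqrt 2\<close> and \<open>sqrt 3\<close>, where the five claims are identities.
\<close>

section \<open>Coordinates, cross product and area in the plane\<close>

lemma vec2_eq_iff: "(x :: real ^ 2) = y \<longleftrightarrow> x $ 1 = y $ 1 \<and> x $ 2 = y $ 2"
  by (simp add: vec_eq_iff forall_2)

lemma inner_vec2: "(x :: real ^ 2) \<bullet> y = x $ 1 * y $ 1 + x $ 2 * y $ 2"
  by (simp add: inner_vec_def sum_2)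

text \<open>Signed area of the parallelogram spanned by the two vectors.\<close>

definition cross2 :: "real ^ 2 \<Rightarrow> real ^ 2 \<Rightarrow> real" where
  "cross2 x y = x $ 1 * y $ 2 - x $ 2 * y $ 1"

lemma cross2_add_left: "cross2 (x + y) z = cross2 x z + cross2 y z"
  and cross2_add_right: "cross2 z (x + y) = cross2 z x + cross2 z y"
  and cross2_diff_left: "cross2 (x - y) z = cross2 x z - cross2 y z"
  and cross2_diff_right: "cross2 z (x - y) = cross2 z x - cross2 z y"
  and cross2_scaleR_left: "cross2 (k *\<^sub>R x) z = k * cross2 x z"
  and cross2_scaleR_right: "cross2 z (k *\<^sub>R x) = k * cross2 z x"
  and cross2_self [simp]: "cross2 x x = 0"
  by (simp_all add: cross2_def algebra_simps)

lemmas cross2_linear = cross2_add_left cross2_add_right cross2_diff_left cross2_diff_right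
  cross2_scaleR_left cross2_scaleR_right

lemma cross2_skew: "cross2 y x = - cross2 x y"
  by (simp add: cross2_def)

text \<open>Lagrange's identity: sin^2 + cos^2 = 1 scaled by the squared norms. For orthogonal
  vectors it turns a cross product into a product of norms, which is how both incircle lemmas obtain
  the radius.\<close>

lemma cross2_lagrange: "(cross2 x y)\<^sup>2 + (x \<bullet> y)\<^sup>2 = (norm x)\<^sup>2 * (norm y)\<^sup>2"
  unfolding power2_norm_eq_inner inner_vec2 cross2_def by algebra

text \<open>The absolute value removes the dependence on orientation, and doubling makes the
  inradius simply this quantity over the perimeter.\<close>

definition double_area :: "real ^ 2 \<Rightarrow> real ^ 2 \<Rightarrow> real ^ 2 \<Rightarrow> real" where
  "double_area A B C = \<bar>cross2 (B - A) (C - A)\<bar>"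

lemma double_area_rotate: "double_area B C A = double_area A B C"
  and double_area_swap: "double_area A C B = double_area A B C"
proof -
  have "cross2 (C - B) (A - B) = cross2 (B - A) (C - A)"
    "cross2 (C - A) (B - A) = - cross2 (B - A) (C - A)"
    by (simp_all add: cross2_def algebra_simps)
  then show "double_area B C A = double_area A B C" "double_area A C B = double_area A B C"
    by (simp_all add: double_area_def)
qed

lemma law_of_cosines:
  fixes A B C :: "'a :: real_inner"
  shows "2 * ((B - A) \<bullet> (C - A)) = (dist C A)\<^sup>2 + (dist A B)\<^sup>2 - (dist B C)\<^sup>2"
  unfolding dist_norm power2_norm_eq_inner by (simp add: inner_simps inner_commute)

lemma double_area_sqr:
  "(double_area A B C)\<^sup>2 =
    (dist A B)\<^sup>2 * (dist A C)\<^sup>2 - ((B - A) \<bullet> (C - A))\<^sup>2"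
  using cross2_lagrange [of "B - A" "C - A"]
  by (simp add: double_area_def dist_norm norm_minus_commute)

text \<open>A vanishing cross product is, by Lagrange's identity, the equality case of
  Cauchy-Schwarz, which means collinearity.\<close>

lemma double_area_pos:
  assumes "\<not> collinear {A, B, C}"
  shows "double_area A B C > 0"
proof (rule ccontr)
  assume "\<not> double_area A B C > 0"
  then have "cross2 (B - A) (C - A) = 0"
    by (simp add: double_area_def)
  then have "((B - A) \<bullet> (C - A))\<^sup>2 = (norm (B - A) * norm (C - A))\<^sup>2"
    using cross2_lagrange [of "B - A" "C - A"] by (simp add: power_mult_distrib)
  then have "\<bar>(B - A) \<bullet> (C - A)\<bar> = norm (B - A) * norm (C - A)"
    by (auto simp only: power2_eq_iff abs_minus_cancel abs_mult abs_norm_cancel)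
  then have "collinear {B, A, C}"
    unfolding norm_cauchy_schwarz_equal by (subst collinear_3) simp
  with assms show False
    by (simp add: insert_commute)
qed

lemma double_area_pos_imp_distinct:
  assumes "double_area A B C > 0"
  shows "A \<noteq> B" "B \<noteq> C" "C \<noteq> A"
  using assms by (auto simp: double_area_def cross2_def algebra_simps)

section \<open>Tangency, and existence and uniqueness of the incircle\<close>

text \<open>Reflecting a common point in the foot of the perpendicular from \<open>I\<close> gives
  another common point, so a single one must be the foot itself. This replaces the set-theoretic
  condition by an equation for the parameter \<open>k\<close> of the touching point.\<close>

lemma tangent_to_side_iff:
  assumes "X \<noteq> Y"
  shows "tangent_to_side I r X Y \<longleftrightarrow>
    (\<exists>k. 0 \<le> k \<and> k \<le> 1 \<and> dist I (X + k *\<^sub>R (Y - X)) = r \<and>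
      (I - (X + k *\<^sub>R (Y - X))) \<bullet> (Y - X) = 0)"
proof -
  define w where "w = Y - X"
  have w: "w \<bullet> w > 0" using assms by (simp add: w_def)
  have seg: "T \<in> closed_segment X Y \<longleftrightarrow> (\<exists>k. 0 \<le> k \<and> k \<le> 1 \<and> T = X + k *\<^sub>R w)" for T
    by (auto simp: in_segment w_def algebra_simps)
  have hull: "T \<in> affine hull {X, Y} \<longleftrightarrow> (\<exists>k. T = X + k *\<^sub>R w)" for T
  proof -
    have "T \<in> affine hull {X, Y} \<longleftrightarrow> (\<exists>u v. T = u *\<^sub>R X + v *\<^sub>R Y \<and> u + v = 1)"
      by (simp add: affine_hull_2)
    also have "\<dots> \<longleftrightarrow> (\<exists>k. T = (1 - k) *\<^sub>R X + k *\<^sub>R Y)"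
      by (metis add.commute add_diff_cancel_left' diff_add_cancel)
    finally show ?thesis by (simp add: w_def algebra_simps)
  qed
  have sq: "(dist I (T + m *\<^sub>R w))\<^sup>2 = (dist I T)\<^sup>2 - 2 * m * ((I - T) \<bullet> w) + m\<^sup>2 * (w \<bullet> w)" for T m
    unfolding dist_norm power2_norm_eq_inner
    by (simp add: inner_simps inner_commute power2_eq_square algebra_simps)
  have "sphere I r \<inter> affine hull {X, Y} = {T} \<longleftrightarrow> dist I T = r \<and> (I - T) \<bullet> w = 0"
    if T: "T = X + k *\<^sub>R w" for T k
  proof
    assume eq: "sphere I r \<inter> affine hull {X, Y} = {T}"
    then have r: "dist I T = r" by auto
    \<comment> \<open>\<open>T + m *\<^sub>R w\<close> is the reflection of \<open>T\<close> in the
      foot of the perpendicular from \<open>I\<close>; uniqueness of the common point forces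
      \<open>m = 0\<close>.\<close>
    define m where "m = 2 * ((I - T) \<bullet> w) / (w \<bullet> w)"
    have "(dist I (T + m *\<^sub>R w))\<^sup>2 = (dist I T)\<^sup>2"
      unfolding sq m_def using w by (simp add: field_simps power2_eq_square)
    then have "dist I (T + m *\<^sub>R w) = r"
      using r by (metis power2_eq_iff_nonneg zero_le_dist)
    moreover have "T + m *\<^sub>R w \<in> affine hull {X, Y}"
      unfolding hull T by (metis add.assoc scaleR_add_left)
    ultimately have "T + m *\<^sub>R w \<in> {T}"
      unfolding eq [symmetric] by simp
    then show "dist I T = r \<and> (I - T) \<bullet> w = 0"
      using w r by (auto simp: m_def)
  next
    assume *: "dist I T = r \<and> (I - T) \<bullet> w = 0"
    have "Q = T" if "dist I Q = r" "Q \<in> affine hull {X, Y}" for Q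
    proof -
      from that obtain l where "Q = X + l *\<^sub>R w" by (auto simp: hull)
      then have Q: "Q = T + (l - k) *\<^sub>R w" by (simp add: T algebra_simps)
      \<comment> \<open>By Pythagoras, a point of the line other than the foot \<open>T\<close> is
        strictly farther from \<open>I\<close>.\<close>
      from sq [of T "l - k"] show ?thesis using * that(1) w by (simp add: Q)
    qed
    with * T hull show "sphere I r \<inter> affine hull {X, Y} = {T}" by auto
  qed
  then show ?thesis
    unfolding tangent_to_side_def Bex_def seg w_def [symmetric] by metis
qed

text \<open>The touching point on \<open>AB\<close> is guessed from the tangent length
  \<open>(b + c - a) / 2\<close> at \<open>A\<close>; it then remains to check orthogonality and
  distance. The other two sides follow by rotating the vertices.\<close>

lemma incenter_tangent_to_side:
  fixes A B C :: "real ^ 2"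
  defines "a \<equiv> dist B C" and "b \<equiv> dist C A" and "c \<equiv> dist A B"
  assumes "double_area A B C > 0"
  shows "tangent_to_side (A + (b / (a + b + c)) *\<^sub>R (B - A) + (c / (a + b + c)) *\<^sub>R (C - A))
    (double_area A B C / (a + b + c)) A B"
proof -
  define u v where "u = B - A" and "v = C - A"
  note distinct = double_area_pos_imp_distinct [OF assms(4)]
  have pos: "a > 0" "b > 0" "c > 0"
    using distinct by (simp_all add: a_def b_def c_def)
  define s where "s = a + b + c"
  have s: "s > 0" using pos by (simp add: s_def)
  have uu: "u \<bullet> u = c\<^sup>2"
    unfolding c_def u_def by (metis dist_commute dist_norm power2_norm_eq_inner)
  have uv: "2 * (u \<bullet> v) = b\<^sup>2 + c\<^sup>2 - a\<^sup>2"
    unfolding a_def b_def c_def u_def v_def by (rule law_of_cosines)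
  \<comment> \<open>The tangent length at \<open>A\<close> as a fraction of the side
    \<open>AB\<close>.\<close>
  define k where "k = (b + c - a) / (2 * c)"
  define w where "w = (b / s) *\<^sub>R u + (c / s) *\<^sub>R v - k *\<^sub>R u"
  have "w \<bullet> u = (b / s) * c\<^sup>2 + (c / s) * ((b\<^sup>2 + c\<^sup>2 - a\<^sup>2) / 2) - k * c\<^sup>2"
    by (simp add: w_def inner_simps uu inner_commute [of v u] flip: uv)
  also have "\<dots> = c * (2 * b * c + (b\<^sup>2 + c\<^sup>2 - a\<^sup>2) - s * (b + c - a)) / (2 * s)"
    using pos s by (simp add: k_def field_simps power2_eq_square)
  also have "2 * b * c + (b\<^sup>2 + c\<^sup>2 - a\<^sup>2) - s * (b + c - a) = 0"
    unfolding s_def by algebra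
  finally have orth: "w \<bullet> u = 0" by simp
  \<comment> \<open>Crossing with \<open>u\<close> kills the \<open>u\<close> components; since
    \<open>w\<close> is orthogonal to \<open>u\<close>, the absolute value of this is
    \<open>c * norm w\<close>.\<close>
  have "cross2 u w = c / s * cross2 u v"
    by (simp add: w_def cross2_linear)
  with cross2_lagrange [of u w] orth have "(c / s * cross2 u v)\<^sup>2 = (c * norm w)\<^sup>2"
    by (simp add: inner_commute power_mult_distrib power2_norm_eq_inner uu)
  then have "\<bar>c / s * cross2 u v\<bar> = \<bar>c * norm w\<bar>"
    by (simp only: power2_eq_iff abs_eq_iff)
  then have norm: "norm w = double_area A B C / s"
    using pos s by (simp add: abs_mult double_area_def u_def v_def field_simps)
  \<comment> \<open>Two triangle inequalities place the touching point inside the side.\<close>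
  have "a \<le> b + c" "b \<le> a + c"
    unfolding a_def b_def c_def by metric+
  then have "0 \<le> k" "k \<le> 1"
    using pos by (simp_all add: k_def field_simps)
  moreover have "A + (b / s) *\<^sub>R u + (c / s) *\<^sub>R v - (A + k *\<^sub>R u) = w"
    by (simp add: w_def)
  ultimately show ?thesis
    unfolding tangent_to_side_iff [OF distinct(1)] dist_norm
      s_def [symmetric] u_def [symmetric] v_def [symmetric]
    using orth norm by metis
qed

text \<open>Both sides are the point with barycentric weights \<open>p\<close>, \<open>q\<close>,
  \<open>w\<close>, written from the base points \<open>A\<close> and \<open>B\<close>.\<close>

lemma barycentric_rotate:
  fixes A B C :: "'a :: real_vector"
  assumes "p + q + w = 1"
  shows "A + q *\<^sub>R (B - A) + w *\<^sub>R (C - A) = B + w *\<^sub>R (C - B) + p *\<^sub>R (A - B)"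
proof -
  have "p = 1 - q - w" using assms by simp
  then show ?thesis
    by (simp only: scaleR_left_diff_distrib scaleR_right_diff_distrib scaleR_one) simp
qed

lemma is_incircle_exists:
  fixes A B C :: "real ^ 2"
  defines "a \<equiv> dist B C" and "b \<equiv> dist C A" and "c \<equiv> dist A B"
  assumes area: "double_area A B C > 0"
  shows "is_incircle A B C (A + (b / (a + b + c)) *\<^sub>R (B - A) + (c / (a + b + c)) *\<^sub>R (C - A))
    (double_area A B C / (a + b + c))" (is "is_incircle A B C ?I ?r")
proof -
  have pos: "a + b + c > 0"
    using double_area_pos_imp_distinct [OF area] by (simp add: a_def b_def c_def add_pos_pos)
  have "a / (a + b + c) + b / (a + b + c) + c / (a + b + c) = 1"
    using pos by (simp flip: add_divide_distrib)
  then have 1: "?I = B + (c / (b + c + a)) *\<^sub>R (C - B) + (a / (b + c + a)) *\<^sub>R (A - B)"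
    and 2: "?I = C + (a / (c + a + b)) *\<^sub>R (A - C) + (b / (c + a + b)) *\<^sub>R (B - C)"
    using barycentric_rotate [of "a / (a + b + c)" "b / (a + b + c)" "c / (a + b + c)" A B C]
      barycentric_rotate [of "b / (a + b + c)" "c / (a + b + c)" "a / (a + b + c)" B C A]
    by (simp_all only: add_ac)
  have "tangent_to_side ?I ?r A B"
    using incenter_tangent_to_side [OF area] by (simp add: a_def b_def c_def)
  moreover have "tangent_to_side ?I ?r B C"
    unfolding 1 using incenter_tangent_to_side [of B C A] area
    by (simp add: a_def b_def c_def double_area_rotate add_ac)
  moreover have "tangent_to_side ?I ?r C A"
    unfolding 2 using incenter_tangent_to_side [of C A B] area
    by (simp add: a_def b_def c_def double_area_rotate [of B C A] double_area_rotate [of A B C] add_ac)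
  ultimately show ?thesis
    using area pos by (simp add: is_incircle_def)
qed

text \<open>Pythagoras at the touching points makes the two tangent segments at each vertex equal.
  This fixes their lengths, hence the inner products of \<open>I - A\<close> with both sides at
  \<open>A\<close>, hence \<open>I\<close>.\<close>

lemma is_incircle_unique:
  fixes A B C :: "real ^ 2"
  defines "a \<equiv> dist B C" and "b \<equiv> dist C A" and "c \<equiv> dist A B"
  assumes area: "double_area A B C > 0" and inc: "is_incircle A B C I r"
  shows "I = A + (b / (a + b + c)) *\<^sub>R (B - A) + (c / (a + b + c)) *\<^sub>R (C - A)"
    and "r = double_area A B C / (a + b + c)"
proof -
  define u v where "u = B - A" and "v = C - A"
  note distinct = double_area_pos_imp_distinct [OF area]
  have pos: "a > 0" "b > 0" "c > 0"
    using distinct by (simp_all add: a_def b_def c_def)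
  define s where "s = a + b + c"
  have s: "s > 0" using pos by (simp add: s_def)
  have tangent_lengths: "\<exists>k. 0 \<le> k \<and> k \<le> 1 \<and> (dist I X)\<^sup>2 = r\<^sup>2 + (k * dist X Y)\<^sup>2 \<and>
      (dist I Y)\<^sup>2 = r\<^sup>2 + ((1 - k) * dist X Y)\<^sup>2 \<and>
      (I - X) \<bullet> (Y - X) = k * (dist X Y)\<^sup>2 \<and> dist I (X + k *\<^sub>R (Y - X)) = r"
    if "tangent_to_side I r X Y" "X \<noteq> Y" for X Y
  proof -
    from that obtain k where k: "0 \<le> k" "k \<le> 1" "dist I (X + k *\<^sub>R (Y - X)) = r"
      "(I - (X + k *\<^sub>R (Y - X))) \<bullet> (Y - X) = 0"
      by (auto simp: tangent_to_side_iff)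
    define T where "T = X + k *\<^sub>R (Y - X)"
    have X: "I - X = (I - T) + k *\<^sub>R (Y - X)" and Y: "I - Y = (I - T) + (k - 1) *\<^sub>R (Y - X)"
      by (simp_all add: T_def algebra_simps)
    have XY: "(Y - X) \<bullet> (Y - X) = (dist X Y)\<^sup>2"
      by (metis dist_commute dist_norm power2_norm_eq_inner)
    have IT: "(I - T) \<bullet> (I - T) = r\<^sup>2" and orth: "(I - T) \<bullet> (Y - X) = 0"
      using k(3,4) by (simp_all add: T_def dist_norm flip: power2_norm_eq_inner)
    have *: "((I - T) + m *\<^sub>R (Y - X)) \<bullet> ((I - T) + m *\<^sub>R (Y - X)) = r\<^sup>2 + (m * dist X Y)\<^sup>2" for m
      by (simp only: inner_add_left inner_add_right inner_scaleR_left inner_scaleR_right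
          XY IT orth inner_commute [of "Y - X" "I - T"] power_mult_distrib)
         (simp add: power2_eq_square)
    have "(dist I X)\<^sup>2 = r\<^sup>2 + (k * dist X Y)\<^sup>2"
      unfolding dist_norm [of I X] power2_norm_eq_inner X by (rule *)
    moreover have "(dist I Y)\<^sup>2 = r\<^sup>2 + ((k - 1) * dist X Y)\<^sup>2"
      unfolding dist_norm [of I Y] power2_norm_eq_inner Y by (rule *)
    moreover have "(I - X) \<bullet> (Y - X) = k * (dist X Y)\<^sup>2"
      unfolding X inner_add_left orth by (simp add: XY)
    ultimately show ?thesis
      using k(1-3) by (intro exI [of _ k]) (simp add: power_mult_distrib power2_commute)
  qed
  have r: "r > 0" and t: "tangent_to_side I r A B" "tangent_to_side I r B C" "tangent_to_side I r C A"
    using inc by (simp_all add: is_incircle_def)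
  obtain k where k: "0 \<le> k" "k \<le> 1" "(dist I A)\<^sup>2 = r\<^sup>2 + (k * c)\<^sup>2"
      "(dist I B)\<^sup>2 = r\<^sup>2 + ((1 - k) * c)\<^sup>2"
      "(I - A) \<bullet> u = k * c\<^sup>2" "dist I (A + k *\<^sub>R u) = r"
    using tangent_lengths [OF t(1) distinct(1)] by (auto simp: c_def u_def)
  obtain l where l: "0 \<le> l" "l \<le> 1" "(dist I B)\<^sup>2 = r\<^sup>2 + (l * a)\<^sup>2"
      "(dist I C)\<^sup>2 = r\<^sup>2 + ((1 - l) * a)\<^sup>2"
    using tangent_lengths [OF t(2) distinct(2)] by (auto simp: a_def)
  obtain m where m: "0 \<le> m" "m \<le> 1" "(dist I C)\<^sup>2 = r\<^sup>2 + (m * b)\<^sup>2"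
      "(dist I A)\<^sup>2 = r\<^sup>2 + ((1 - m) * b)\<^sup>2"
      "(I - C) \<bullet> (A - C) = m * b\<^sup>2"
    using tangent_lengths [OF t(3) distinct(3)] by (auto simp: b_def)
  \<comment> \<open>Each vertex has two expressions for its squared distance from \<open>I\<close>,
    one for each side through it.\<close>
  have "(k * c)\<^sup>2 = ((1 - m) * b)\<^sup>2" "((1 - k) * c)\<^sup>2 = (l * a)\<^sup>2" "((1 - l) * a)\<^sup>2 = (m * b)\<^sup>2"
    using k l m by simp_all
  then have "k * c = (1 - m) * b" "(1 - k) * c = l * a" "(1 - l) * a = m * b"
    using k l m pos by (auto intro: power2_eq_imp_eq)
  then have kc: "2 * (k * c) = b + c - a" and mb: "2 * ((1 - m) * b) = b + c - a"
    by (simp_all add: algebra_simps)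
  have uu: "u \<bullet> u = c\<^sup>2" and vv: "v \<bullet> v = b\<^sup>2"
    unfolding b_def c_def u_def v_def
    by (metis dist_commute dist_norm power2_norm_eq_inner)+
  have uv: "2 * (u \<bullet> v) = b\<^sup>2 + c\<^sup>2 - a\<^sup>2"
    unfolding a_def b_def c_def u_def v_def by (rule law_of_cosines)
  have "(I - C) \<bullet> (A - C) = v \<bullet> v - (I - A) \<bullet> v"
    by (simp add: v_def inner_simps inner_commute)
  then have Iv: "(I - A) \<bullet> v = (1 - m) * b\<^sup>2"
    using m(5) vv by (simp add: algebra_simps)
  \<comment> \<open>The deviation of \<open>I\<close> from the claimed centre; it will be orthogonal
    to both \<open>u\<close> and \<open>v\<close>.\<close>
  define w where "w = I - A - ((b / s) *\<^sub>R u + (c / s) *\<^sub>R v)"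
  have w: "w \<bullet> x = (I - A) \<bullet> x - (b * (u \<bullet> x) + c * (v \<bullet> x)) / s" for x
    unfolding w_def inner_diff_left [of "I - A"] by (simp add: inner_add_left add_divide_distrib)
  have "2 * s * (w \<bullet> u) = s * (2 * (k * c)) * c - (2 * b * c\<^sup>2 + c * (2 * (u \<bullet> v)))"
    using s by (simp add: w k(5) uu inner_commute [of v u] power2_eq_square field_simps)
  also have "\<dots> = 0"
    unfolding kc uv s_def by algebra
  finally have wu: "w \<bullet> u = 0" using s by simp
  have "2 * s * (w \<bullet> v) = s * (2 * ((1 - m) * b)) * b - (b * (2 * (u \<bullet> v)) + 2 * c * b\<^sup>2)"
    using s by (simp add: w Iv vv power2_eq_square field_simps)
  also have "\<dots> = 0"
    unfolding mb uv s_def by algebra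
  finally have wv: "w \<bullet> v = 0" using s by simp
  have cross: "cross2 u v \<noteq> 0"
    using area by (simp add: double_area_def u_def v_def)
  \<comment> \<open>Cramer's rule recovers \<open>w\<close> from its inner products with
    \<open>u\<close> and \<open>v\<close>.\<close>
  have "cross2 u v * w $ 1 = (w \<bullet> u) * v $ 2 - (w \<bullet> v) * u $ 2"
    "cross2 u v * w $ 2 = (w \<bullet> v) * u $ 1 - (w \<bullet> u) * v $ 1"
    by (simp_all add: cross2_def inner_vec2 algebra_simps)
  then have "w = 0"
    using wu wv cross by (simp add: vec2_eq_iff)
  then have I: "I = A + (b / s) *\<^sub>R u + (c / s) *\<^sub>R v"
    by (simp add: w_def algebra_simps)
  then show "I = A + (b / (a + b + c)) *\<^sub>R (B - A) + (c / (a + b + c)) *\<^sub>R (C - A)"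
    by (simp add: s_def u_def v_def)
  \<comment> \<open>The radius vector at the touching point on \<open>AB\<close>; its cross product
    with \<open>u\<close> determines \<open>r\<close>.\<close>
  define z where "z = I - (A + k *\<^sub>R u)"
  have "cross2 u z = c / s * cross2 u v"
    by (simp add: z_def I cross2_linear)
  moreover have "z \<bullet> u = (I - A) \<bullet> u - k * (u \<bullet> u)"
    unfolding z_def by (simp add: inner_simps)
  then have "u \<bullet> z = 0"
    using k(5) uu by (simp add: inner_commute)
  moreover have "norm z = r"
    using k(6) by (simp add: z_def dist_norm)
  ultimately have "(c / s * cross2 u v)\<^sup>2 = (c * r)\<^sup>2"
    using cross2_lagrange [of u z]
    by (simp add: power_mult_distrib power2_norm_eq_inner [of u] uu)
  then have "\<bar>c / s * cross2 u v\<bar> = \<bar>c * r\<bar>"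
    by (simp only: power2_eq_iff abs_eq_iff)
  then show "r = double_area A B C / (a + b + c)"
    unfolding s_def [symmetric] using pos s r by (simp add: abs_mult double_area_def u_def v_def field_simps)
qed

lemma incenter_eq:
  assumes "double_area A B C > 0"
  shows "incenter A B C = A + (dist C A / (dist B C + dist C A + dist A B)) *\<^sub>R (B - A)
    + (dist A B / (dist B C + dist C A + dist A B)) *\<^sub>R (C - A)"
  unfolding incenter_def
  by (rule the_equality) (use is_incircle_exists [OF assms] is_incircle_unique(1) [OF assms] in metis)+

lemma inradius_eq:
  assumes "double_area A B C > 0"
  shows "inradius A B C = double_area A B C / (dist B C + dist C A + dist A B)"
  unfolding inradius_def
  by (rule the_equality) (use is_incircle_exists [OF assms] is_incircle_unique(2) [OF assms] in metis)+

section \<open>Independence of the order of the vertices\<close>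

lemma tangent_to_side_commute: "tangent_to_side I r Y X \<longleftrightarrow> tangent_to_side I r X Y"
  by (simp add: tangent_to_side_def closed_segment_commute insert_commute)

lemma is_incircle_rotate: "is_incircle B C A I r \<longleftrightarrow> is_incircle A B C I r"
  by (auto simp: is_incircle_def)

lemma incenter_rotate: "incenter B C A = incenter A B C"
  by (simp add: incenter_def is_incircle_rotate [of B C A])

lemma is_incircle_swap: "is_incircle A C B I r \<longleftrightarrow> is_incircle A B C I r"
  by (auto simp: is_incircle_def tangent_to_side_commute)

lemma incenter_swap: "incenter A C B = incenter A B C"
  by (simp add: incenter_def is_incircle_swap [of A C B])

lemma inradius_swap: "inradius A C B = inradius A B C"
  by (simp add: inradius_def is_incircle_swap [of A C B])

section \<open>Distances and cevians from the incenter\<close>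

text \<open>Expanding the square of \<open>b *\<^sub>R u + c *\<^sub>R v\<close> with the law of
  cosines leaves \<open>b * c * ((b + c)\<^sup>2 - a\<^sup>2)\<close>, whose factor
  \<open>a + b + c\<close> cancels.\<close>

lemma dist_incenter_sqr:
  fixes A B C :: "real ^ 2"
  defines "a \<equiv> dist B C" and "b \<equiv> dist C A" and "c \<equiv> dist A B"
  assumes area: "double_area A B C > 0"
  shows "(dist (incenter A B C) A)\<^sup>2 = b * c * (b + c - a) / (a + b + c)"
proof -
  define s where "s = a + b + c"
  have s: "s > 0"
    using double_area_pos_imp_distinct [OF area] by (simp add: s_def a_def b_def c_def add_pos_pos)
  define u v where "u = B - A" and "v = C - A"
  have uu: "u \<bullet> u = c\<^sup>2" and vv: "v \<bullet> v = b\<^sup>2"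
    unfolding b_def c_def u_def v_def
    by (metis dist_commute dist_norm power2_norm_eq_inner)+
  have uv: "2 * (u \<bullet> v) = b\<^sup>2 + c\<^sup>2 - a\<^sup>2"
    unfolding a_def b_def c_def u_def v_def by (rule law_of_cosines)
  have I: "incenter A B C - A = (1 / s) *\<^sub>R (b *\<^sub>R u + c *\<^sub>R v)"
    unfolding incenter_eq [OF area] a_def [symmetric] b_def [symmetric] c_def [symmetric]
      s_def [symmetric] u_def [symmetric] v_def [symmetric]
    by (simp add: scaleR_add_right)
  have "(dist (incenter A B C) A)\<^sup>2 = (b\<^sup>2 * (u \<bullet> u) + b * c * (2 * (u \<bullet> v)) + c\<^sup>2 * (v \<bullet> v)) / s\<^sup>2"
    unfolding dist_norm power2_norm_eq_inner I inner_scaleR_left inner_scaleR_right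
      inner_add_left inner_add_right inner_commute [of v u]
    using s by (simp add: power2_eq_square field_simps)
  also have "b\<^sup>2 * (u \<bullet> u) + b * c * (2 * (u \<bullet> v)) + c\<^sup>2 * (v \<bullet> v) = b * c * (b + c - a) * s"
    unfolding uu vv uv s_def by algebra
  finally show ?thesis
    using s by (simp add: s_def [symmetric] power2_eq_square)
qed

text \<open>The angle bisector theorem, obtained by comparing the coordinates of
  \<open>D - A\<close> in the basis \<open>u\<close>, \<open>v\<close>.\<close>

lemma cevian_incenter:
  fixes A B C D :: "real ^ 2"
  defines "b \<equiv> dist C A" and "c \<equiv> dist A B"
  assumes area: "double_area A B C > 0"
    and D: "D \<in> affine hull {A, incenter A B C}" "D \<in> closed_segment B C"
  shows "D = B + (c / (b + c)) *\<^sub>R (C - B)"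
proof -
  define u v where "u = B - A" and "v = C - A"
  have pos: "b > 0" "c > 0" "dist B C > 0"
    using double_area_pos_imp_distinct [OF area] by (simp_all add: b_def c_def)
  define s where "s = dist B C + b + c"
  have s: "s > 0" unfolding s_def using pos by linarith
  have cross: "cross2 u v \<noteq> 0"
    using area by (simp add: double_area_def u_def v_def)
  have I: "incenter A B C - A = (b / s) *\<^sub>R u + (c / s) *\<^sub>R v"
    unfolding incenter_eq [OF area] by (simp add: s_def u_def v_def b_def c_def)
  from D(1) obtain l m where lm: "D = l *\<^sub>R A + m *\<^sub>R incenter A B C" "l + m = 1"
    by (auto simp: affine_hull_2)
  have "D - A = m *\<^sub>R (incenter A B C - A)"
    unfolding lm(1) using lm(2) by (simp add: algebra_simps eq_diff_eq flip: scaleR_add_left)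
  then have D1: "D - A = m *\<^sub>R ((b / s) *\<^sub>R u + (c / s) *\<^sub>R v)"
    by (simp add: I)
  from D(2) obtain k where k: "D = (1 - k) *\<^sub>R B + k *\<^sub>R C"
    by (auto simp: in_segment)
  then have D2: "D - A = (1 - k) *\<^sub>R u + k *\<^sub>R v"
    by (simp add: u_def v_def algebra_simps)
  \<comment> \<open>Crossing with \<open>u\<close> and with \<open>v\<close> extracts the two
    coordinates.\<close>
  have "cross2 u ((1 - k) *\<^sub>R u + k *\<^sub>R v) = cross2 u (m *\<^sub>R ((b / s) *\<^sub>R u + (c / s) *\<^sub>R v))"
    and "cross2 ((1 - k) *\<^sub>R u + k *\<^sub>R v) v = cross2 (m *\<^sub>R ((b / s) *\<^sub>R u + (c / s) *\<^sub>R v)) v"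
    using D1 D2 by simp_all
  then have "k * cross2 u v = m * c / s * cross2 u v" "(1 - k) * cross2 u v = m * b / s * cross2 u v"
    by (simp_all add: cross2_linear)
  then have km: "k = m * c / s" "1 - k = m * b / s"
    using cross by (metis mult_right_cancel)+
  have "c * (1 - k) = k * b"
    unfolding km(2) unfolding km(1) by simp
  then have "k * (b + c) = c"
    by (simp add: algebra_simps)
  then have "k = c / (b + c)"
    using pos by (simp add: field_simps)
  then show ?thesis
    using k by (simp add: algebra_simps)
qed

text \<open>Area over perimeter for \<open>PBD\<close>, with the common denominator
  \<open>b + c\<close> of the sides cleared. The distances from \<open>P\<close> stay symbolic, so
  the formula is free of square roots and can be reused for the other five triangles.\<close>

lemma inradius_cevian:
  fixes A B C P D :: "real ^ 2"
  defines "a \<equiv> dist B C" and "b \<equiv> dist C A" and "c \<equiv> dist A B"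
  assumes area: "double_area A B C > 0" and P: "P = incenter A B C"
    and D: "D \<in> affine hull {A, P}" "D \<in> closed_segment B C"
  shows "inradius P B D = double_area A B C * a * c /
    ((a + b + c) * ((b + c) * dist P B + a * c + a * dist P A))"
proof -
  define u v where "u = B - A" and "v = C - A"
  have pos: "a > 0" "b > 0" "c > 0"
    using double_area_pos_imp_distinct [OF area] by (simp_all add: a_def b_def c_def)
  define s where "s = a + b + c"
  have s: "s > 0" using pos by (simp add: s_def)
  have bc: "b + c > 0" using pos by simp
  have D_eq: "D = B + (c / (b + c)) *\<^sub>R (C - B)"
    using cevian_incenter [OF area] D unfolding P b_def c_def by blast
  have P_eq: "P = A + (b / s) *\<^sub>R u + (c / s) *\<^sub>R v"
    unfolding P incenter_eq [OF area] by (simp add: s_def u_def v_def a_def b_def c_def)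
  have "D - B = (c / (b + c)) *\<^sub>R (C - B)"
    by (simp add: D_eq)
  then have BD: "dist B D = a * c / (b + c)"
    using pos by (simp add: dist_norm a_def norm_minus_commute [of B])
  have "D - A = (b / (b + c)) *\<^sub>R u + (c / (b + c)) *\<^sub>R v"
  proof -
    have "b / (b + c) = 1 - c / (b + c)"
      using bc by (simp add: field_simps)
    then show ?thesis
      unfolding D_eq u_def v_def by (simp only:) (simp add: algebra_simps)
  qed
  \<comment> \<open>The incenter divides the bisector so that
    \<open>AP : PD = (b + c) : a\<close>.\<close>
  also have "\<dots> = (s / (b + c)) *\<^sub>R (P - A)"
    using s by (simp add: P_eq scaleR_add_right)
  finally have "D - P = (s / (b + c)) *\<^sub>R (P - A) - (P - A)"
    by (simp add: algebra_simps)
  also have "\<dots> = (s / (b + c) - 1) *\<^sub>R (P - A)"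
    by (simp add: scaleR_left_diff_distrib)
  also have "s / (b + c) - 1 = a / (b + c)"
    using bc by (simp add: s_def field_simps)
  finally have DP: "dist D P = a / (b + c) * dist P A"
    using pos by (simp add: dist_norm)
  have PB: "P - B = (b / s - 1) *\<^sub>R u + (c / s) *\<^sub>R v"
    by (simp add: P_eq u_def v_def algebra_simps)
  have DB: "D - B = (c / (b + c)) *\<^sub>R (v - u)"
    by (simp add: D_eq u_def v_def)
  \<comment> \<open>The factor \<open>c / (b + c)\<close> comes from \<open>D\<close> on
    \<open>BC\<close>, and the remaining one, \<open>a / s\<close>, is the barycentric weight of
    \<open>P\<close> at \<open>A\<close>.\<close>
  have "cross2 (D - B) (P - B) = (c / (b + c)) * (1 - b / s - c / s) * cross2 u v"
    unfolding PB DB by (simp add: cross2_linear cross2_skew [of v u] algebra_simps)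
  also have "1 - b / s - c / s = a / s"
  proof -
    have "a = s - b - c" by (simp add: s_def)
    then show ?thesis
      using s by (simp add: diff_divide_distrib)
  qed
  finally have area': "double_area P B D = double_area A B C * (a * c / ((b + c) * s))"
    using pos s unfolding double_area_rotate [of B D P, symmetric] unfolding double_area_def
    by (simp add: abs_mult u_def v_def)
  have "double_area P B D > 0"
    unfolding area' using area pos s by simp
  from inradius_eq [OF this] have "inradius P B D = double_area A B C * (a * c / ((b + c) * s)) /
      (a * c / (b + c) + a / (b + c) * dist P A + dist P B)"
    unfolding area' BD DP .
  also have "a * c / (b + c) + a / (b + c) * dist P A + dist P B =
      ((b + c) * dist P B + a * c + a * dist P A) / (b + c)"
    using bc by (simp add: add_divide_distrib)
  finally show ?thesis
    using bc s unfolding s_def [symmetric] by (simp add: mult_ac)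
qed

section \<open>The triangle with angles 30, 60 and 90 degrees\<close>

lemma inner_eq_cos_vertex_angle:
  "(A - B) \<bullet> (C - B) = norm (A - B) * norm (C - B) * cos (vertex_angle A B C)"
proof (cases "A = B \<or> C = B")
  case False
  then have pos: "norm (A - B) * norm (C - B) > 0" by simp
  have "\<bar>(A - B) \<bullet> (C - B) / (norm (A - B) * norm (C - B))\<bar> \<le> 1"
    using pos Cauchy_Schwarz_ineq2 [of "A - B" "C - B"] by (simp add: abs_mult)
  then show ?thesis
    using pos by (simp add: vertex_angle_def cos_arccos_abs)
qed auto

text \<open>The laws of cosines at \<open>B\<close> and \<open>C\<close> alone determine the ratios
  of the sides; the right angle at \<open>A\<close> then appears as a vanishing inner product and
  gives the area.\<close>

lemma sides_of_30_60_90: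
  fixes A B C :: "real ^ 2"
  assumes "\<not> collinear {A, B, C}"
    and "vertex_angle A B C = pi / 6" and "vertex_angle A C B = pi / 3"
  shows "dist B C = 2 * dist C A" and "dist A B = sqrt 3 * dist C A"
    and "double_area A B C = sqrt 3 * (dist C A)\<^sup>2"
proof -
  define a b c where "a = dist B C" and "b = dist C A" and "c = dist A B"
  define q :: real where "q = sqrt 3"
  have q: "q > 0" "q\<^sup>2 = 3" by (simp_all add: q_def)
  have pos: "a > 0" "b > 0" "c > 0"
    using double_area_pos_imp_distinct [OF double_area_pos [OF assms(1)]]
    by (simp_all add: a_def b_def c_def)
  have "2 * ((C - B) \<bullet> (A - B)) = q * a * c"
    using inner_eq_cos_vertex_angle [of A B C] assms(2)
    by (simp add: q_def a_def c_def dist_norm norm_minus_commute inner_commute cos_30 mult_ac)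
  then have B: "q * a * c = c\<^sup>2 + a\<^sup>2 - b\<^sup>2"
    using law_of_cosines [of C B A] by (simp add: a_def b_def c_def dist_commute)
  have "2 * ((A - C) \<bullet> (B - C)) = a * b"
    using inner_eq_cos_vertex_angle [of A C B] assms(3)
    by (simp add: a_def b_def dist_norm norm_minus_commute cos_60 mult_ac)
  then have C: "a * b = a\<^sup>2 + b\<^sup>2 - c\<^sup>2"
    using law_of_cosines [of A C B] by (simp add: a_def b_def c_def dist_commute)
  \<comment> \<open>Adding the two laws cancels \<open>b\<close> and \<open>c\<close> squared: the
    projection formula for \<open>BC\<close>.\<close>
  from B C have "a * (2 * a) = a * (q * c + b)"
    by (simp add: power2_eq_square algebra_simps)
  then have a: "2 * a = q * c + b"
    using pos by simp
  \<comment> \<open>Eliminating \<open>a\<close> from the law at \<open>C\<close>; the mixed terms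
    in \<open>b * c\<close> cancel.\<close>
  have "c\<^sup>2 = (q * b)\<^sup>2"
  proof -
    have "4 * (a * b) = (2 * a)\<^sup>2 + 4 * b\<^sup>2 - 4 * c\<^sup>2"
      unfolding C by (simp add: power_mult_distrib)
    moreover have "4 * (a * b) = 2 * (2 * a) * b" by simp
    ultimately have "2 * (q * c + b) * b = (q * c + b)\<^sup>2 + 4 * b\<^sup>2 - 4 * c\<^sup>2"
      unfolding a by simp
    then show ?thesis
      using q(2) by (simp add: power2_eq_square algebra_simps)
  qed
  then have c: "c = q * b"
    using pos q by (auto intro: power2_eq_imp_eq)
  then have a': "a = 2 * b"
    using a q(2) by (simp add: power2_eq_square flip: mult.assoc)
  from a' c show "dist B C = 2 * dist C A" "dist A B = sqrt 3 * dist C A"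
    by (simp_all add: a_def b_def c_def q_def)
  have "2 * ((B - A) \<bullet> (C - A)) = 0"
    unfolding law_of_cosines using a' c q(2)
    by (simp add: a_def [symmetric] b_def [symmetric] c_def [symmetric] power_mult_distrib)
  then have "(double_area A B C)\<^sup>2 = (c * b)\<^sup>2"
    unfolding double_area_sqr by (simp add: b_def c_def dist_commute power_mult_distrib)
  then have "double_area A B C = c * b"
    using pos by (auto intro: power2_eq_imp_eq simp: double_area_def)
  then show "double_area A B C = sqrt 3 * (dist C A)\<^sup>2"
    using c by (simp add: b_def q_def power2_eq_square)
qed

section \<open>The six inradii and the five identities\<close>

theorem theorem6p3:
  fixes A B C P D E F :: "real ^ 2"
    and r1 r2 r3 r4 r5 r6 :: real
  assumes triangle: "\<not> collinear {A, B, C}"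
    and angle_B: "vertex_angle A B C = pi / 6"
    and angle_C: "vertex_angle A C B = pi / 3"
    and P: "P = incenter A B C"
    and D: "D \<in> affine hull {A, P}" "D \<in> closed_segment B C"
    and E: "E \<in> affine hull {B, P}" "E \<in> closed_segment C A"
    and F: "F \<in> affine hull {C, P}" "F \<in> closed_segment A B"
    and r1: "r1 = inradius P B D"
    and r2: "r2 = inradius P D C"
    and r3: "r3 = inradius P C E"
    and r4: "r4 = inradius P E A"
    and r5: "r5 = inradius P A F"
    and r6: "r6 = inradius P F B"
  shows "2 / r1 ^ 4 + 8 / r3 ^ 4 + 6 / r4 ^ 4 + 5 / r5 ^ 4 = 14 / r2 ^ 4 + 20 / r6 ^ 4 \<and>
         3 / r1 ^ 2 + 3 / r2 ^ 2 + 3 / r4 ^ 2 = 3 / r3 ^ 2 + 2 / r5 ^ 2 + 3 / r6 ^ 2 \<and>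
         2 / r1 + 2 / r2 + 1 / r5 + 1 / r6 = 3 / r3 + 2 / r4 \<and>
         3 * r1 + 5 * r3 + 55 * r4 + 22 * r6 = 4 * r2 + 75 * r5 \<and>
         2 * r1 * r3 + 3 * r2 * r4 + 9 * r5 * r1 + 9 * r6 * r2 = 27 * r3 * r5 + r4 * r6"
proof -
  define t where "t = dist C A"
  define p q :: real where "p = sqrt 2" and "q = sqrt 3"
  have p2: "p * p = 2" and q2: "q * q = 3" and "p > 0" and "q > 0"
    by (simp_all add: p_def q_def)
  \<comment> \<open>These nested forms let simp reduce right-associated products, so polynomials in
    \<open>p\<close>, \<open>q\<close> normalize to combinations of 1, \<open>p\<close>,
    \<open>q\<close>, \<open>p * q\<close>.\<close>
  have p2': "p * (p * x) = 2 * x" and q2': "q * (q * x) = 3 * x" for x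
    by (simp_all add: p2 q2 flip: mult.assoc)
  have "q > 1" by (simp add: q_def)
  note surd = p2 q2 p2' q2'
  note area = double_area_pos [OF triangle]
  have area': "double_area B C A > 0" "double_area C A B > 0" "double_area A C B > 0"
      "double_area B A C > 0" "double_area C B A > 0"
    using area by (metis double_area_rotate double_area_swap)+
  have t: "t > 0"
    using double_area_pos_imp_distinct [OF area] by (simp add: t_def)
  note sides = sides_of_30_60_90 [OF triangle angle_B angle_C, folded t_def q_def]
  have sides': "dist C A = t" "dist A C = t" "dist B C = 2 * t" "dist C B = 2 * t"
      "dist A B = q * t" "dist B A = q * t"
    using sides by (simp_all add: t_def dist_commute)
  have S: "double_area A B C = q * t\<^sup>2" "double_area B C A = q * t\<^sup>2" "double_area C A B = q * t\<^sup>2"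
      "double_area A C B = q * t\<^sup>2" "double_area B A C = q * t\<^sup>2" "double_area C B A = q * t\<^sup>2"
    using sides(3) by (metis double_area_rotate double_area_swap)+
  have P': "P = incenter B C A" "P = incenter C A B" "P = incenter A C B"
      "P = incenter B A C" "P = incenter C B A"
    unfolding P by (metis incenter_rotate incenter_swap)+
  have D': "D \<in> closed_segment C B" and E': "E \<in> closed_segment A C" and F': "F \<in> closed_segment B A"
    using D(2) E(2) F(2) by (simp_all add: closed_segment_commute)
  have quotient: "x = y" if "x = n / d" "d > 0" "n = y * d" for x y n d :: real
    using that by simp
  \<comment> \<open>The radical denests: \<open>(q - 1) / (q + 1)\<close> equals
    \<open>(q - 1)\<^sup>2 / 2\<close>.\<close>
  have "(dist P A)\<^sup>2 = (t * (p * q - p) / 2)\<^sup>2"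
    by (rule quotient [OF dist_incenter_sqr [OF area, folded P]])
      (use t \<open>q > 0\<close> in \<open>simp_all add: sides' add_pos_pos algebra_simps power2_eq_square surd\<close>)
  then have PA: "dist P A = t * (p * q - p) / 2"
    using t \<open>p > 0\<close> \<open>q > 1\<close> by (auto intro: power2_eq_imp_eq)
  have "(dist P B)\<^sup>2 = (t * p)\<^sup>2"
    by (rule quotient [OF dist_incenter_sqr [OF area'(1), folded P'(1)]])
      (use t \<open>q > 0\<close> in \<open>simp_all add: sides' add_pos_pos algebra_simps power2_eq_square surd\<close>)
  then have PB: "dist P B = t * p"
    using t \<open>p > 0\<close> by (auto intro: power2_eq_imp_eq)
  have "(dist P C)\<^sup>2 = (t * (q - 1))\<^sup>2"
    by (rule quotient [OF dist_incenter_sqr [OF area'(2), folded P'(2)]])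
      (use t \<open>q > 0\<close> in \<open>simp_all add: sides' add_pos_pos algebra_simps power2_eq_square surd\<close>)
  then have PC: "dist P C = t * (q - 1)"
    using t \<open>q > 1\<close> by (auto intro: power2_eq_imp_eq)
  \<comment> \<open>Reciprocals come first: a proposed value \<open>k\<close> is certified by a
    polynomial identity, without rationalizing denominators.\<close>
  have inverse: "1 / r = k / t"
    if "r = n / d" "d * t = k * n" "n > 0" for r n d k :: real
  proof -
    have "1 / r = d * t / (n * t)" using t that(1) by simp
    also have "\<dots> = k / t" unfolding that(2) using that(3) by simp
    finally show ?thesis .
  qed
  have i1: "1 / r1 = (1 + p + q + p * q) / t"
    unfolding r1
    by (rule inverse [OF inradius_cevian [OF area P D(1) D(2)]])
      (use t \<open>q > 0\<close> in \<open>simp_all add: sides' S PA PB PC algebra_simps power2_eq_square surd\<close>)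
  \<comment> \<open>Read as \<open>P C D\<close>, this is the small triangle of the cevian from
    \<open>A\<close> in the relabelled triangle \<open>A C B\<close>; the other cases relabel
    likewise.\<close>
  have i2: "1 / r2 = (2 + p + 2 * q) / t"
    unfolding r2 inradius_swap [of P D C]
    by (rule inverse [OF inradius_cevian [OF area'(3) P'(3) D(1) D']])
      (use t \<open>q > 0\<close> in \<open>simp_all add: sides' S PA PB PC algebra_simps power2_eq_square surd\<close>)
  have i3: "1 / r3 = (3 + p / 2 + 2 * q + p * q / 2) / t"
    unfolding r3
    by (rule inverse [OF inradius_cevian [OF area'(1) P'(1) E(1) E(2)]])
      (use t \<open>q > 0\<close> in \<open>simp_all add: sides' S PA PB PC algebra_simps power2_eq_square surd\<close>)
  have i4: "1 / r4 = (1 + 2 * p + q + p * q) / t"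
    unfolding r4 inradius_swap [of P E A]
    by (rule inverse [OF inradius_cevian [OF area'(4) P'(4) E(1) E']])
      (use t \<open>q > 0\<close> in \<open>simp_all add: sides' S PA PB PC algebra_simps power2_eq_square surd\<close>)
  have i5: "1 / r5 = (3 + q + p * q) / t"
    unfolding r5
    by (rule inverse [OF inradius_cevian [OF area'(2) P'(2) F(1) F(2)]])
      (use t \<open>q > 0\<close> in \<open>simp_all add: sides' S PA PB PC algebra_simps power2_eq_square surd\<close>)
  have i6: "1 / r6 = (2 + 3 * p / 2 + q + p * q / 2) / t"
    unfolding r6 inradius_swap [of P F B]
    by (rule inverse [OF inradius_cevian [OF area'(5) P'(5) F(1) F']])
      (use t \<open>q > 0\<close> in \<open>simp_all add: sides' S PA PB PC algebra_simps power2_eq_square surd\<close>)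
  \<comment> \<open>Here \<open>x\<close> is the inverse of the surd \<open>k\<close>, again
    certified by one multiplication.\<close>
  have length: "r = t * x" if "1 / r = k / t" "k * x = 1" for r k x :: real
  proof -
    have "k \<noteq> 0" using that(2) by auto
    then have "r = t / k" and "x = 1 / k"
      using that t by (auto simp: field_simps)
    then show ?thesis by simp
  qed
  have square: "c / r ^ 2 = c * y / t ^ 2" if "1 / r = k / t" "k * k = y" for r k y c :: real
  proof -
    have "c / r ^ 2 = c * ((1 / r) * (1 / r))" by (simp add: power2_eq_square)
    also have "\<dots> = c * y / t ^ 2"
      unfolding that(1) by (simp add: that(2) [symmetric] power2_eq_square)
    finally show ?thesis .
  qed
  \<comment> \<open>The square formula is assumed for every numerator because it is needed with
    numerator 1, while the result carries an arbitrary \<open>c\<close>.\<close>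
  have fourth: "c / r ^ 4 = c * z / t ^ 4"
    if "\<And>c. c / r ^ 2 = c * y / t ^ 2" "y * y = z" for r y z c :: real
  proof -
    have "c / r ^ 4 = c * ((1 / r ^ 2) * (1 / r ^ 2))" by (simp flip: power_add)
    also have "\<dots> = c * z / t ^ 4"
      unfolding that(1) by (simp add: that(2) [symmetric] mult_ac flip: power_add)
    finally show ?thesis .
  qed
  have v1: "r1 = t * (1 / 2 - p / 2 - q / 2 + p * q / 2)"
    by (rule length [OF i1]) (simp add: field_simps surd)
  have s1: "c / r1 ^ 2 = c * (12 + 8 * p + 6 * q + 4 * p * q) / t ^ 2" for c
    by (rule square [OF i1]) (simp add: field_simps surd)
  have f1: "c / r1 ^ 4 = c * (476 + 336 * p + 272 * q + 192 * p * q) / t ^ 4" for c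
    by (rule fourth [OF s1]) (simp add: algebra_simps surd)
  have v2: "r2 = t * (- 5 - 7 * p / 2 + 3 * q + 2 * p * q)"
    by (rule length [OF i2]) (simp add: field_simps surd)
  have s2: "c / r2 ^ 2 = c * (18 + 4 * p + 8 * q + 4 * p * q) / t ^ 2" for c
    by (rule square [OF i2]) (simp add: field_simps surd)
  have f2: "c / r2 ^ 4 = c * (644 + 336 * p + 352 * q + 208 * p * q) / t ^ 4" for c
    by (rule fourth [OF s2]) (simp add: algebra_simps surd)
  have v3: "r3 = t * (9 / 2 - 7 * p / 2 - 5 * q / 2 + 2 * p * q)"
    by (rule length [OF i3]) (simp add: field_simps surd)
  have s3: "c / r3 ^ 2 = c * (23 + 9 * p + 13 * q + 5 * p * q) / t ^ 2" for c
    by (rule square [OF i3]) (simp add: field_simps surd)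
  have f3: "c / r3 ^ 4 = c * (1348 + 804 * p + 778 * q + 464 * p * q) / t ^ 4" for c
    by (rule fourth [OF s3]) (simp add: algebra_simps surd)
  have v4: "r4 = t * (- 1 - p / 4 + q / 2 + p * q / 4)"
    by (rule length [OF i4]) (simp add: field_simps surd)
  have s4: "c / r4 ^ 2 = c * (18 + 10 * p + 10 * q + 6 * p * q) / t ^ 2" for c
    by (rule square [OF i4]) (simp add: field_simps surd)
  have f4: "c / r4 ^ 4 = c * (1040 + 720 * p + 600 * q + 416 * p * q) / t ^ 4" for c
    by (rule fourth [OF s4]) (simp add: algebra_simps surd)
  have v5: "r5 = t * (- p / 4 + q / 6 + p * q / 12)"
    by (rule length [OF i5]) (simp add: field_simps surd)
  have s5: "c / r5 ^ 2 = c * (18 + 6 * p + 6 * q + 6 * p * q) / t ^ 2" for c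
    by (rule square [OF i5]) (simp add: field_simps surd)
  have f5: "c / r5 ^ 4 = c * (720 + 432 * p + 360 * q + 288 * p * q) / t ^ 4" for c
    by (rule fourth [OF s5]) (simp add: algebra_simps surd)
  have v6: "r6 = t * (1 / 2 + q / 2 - p * q / 2)"
    by (rule length [OF i6]) (simp add: field_simps surd)
  have s6: "c / r6 ^ 2 = c * (13 + 9 * p + 7 * q + 5 * p * q) / t ^ 2" for c
    by (rule square [OF i6]) (simp add: field_simps surd)
  have f6: "c / r6 ^ 4 = c * (628 + 444 * p + 362 * q + 256 * p * q) / t ^ 4" for c
    by (rule fourth [OF s6]) (simp add: algebra_simps surd)
  \<comment> \<open>The first four claims are linear in the tabulated values, so comparing
    coefficients suffices; only the last, with products of radii, needs \<open>surd\<close>.\<close>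
  have "2 / r1 ^ 4 + 8 / r3 ^ 4 + 6 / r4 ^ 4 + 5 / r5 ^ 4 = 14 / r2 ^ 4 + 20 / r6 ^ 4"
    unfolding f1 f2 f3 f4 f5 f6 by (simp add: algebra_simps flip: add_divide_distrib)
  moreover have "3 / r1 ^ 2 + 3 / r2 ^ 2 + 3 / r4 ^ 2 = 3 / r3 ^ 2 + 2 / r5 ^ 2 + 3 / r6 ^ 2"
    unfolding s1 s2 s3 s4 s5 s6 by (simp add: algebra_simps flip: add_divide_distrib)
  moreover have "2 * (1 / r1) + 2 * (1 / r2) + 1 / r5 + 1 / r6 = 3 * (1 / r3) + 2 * (1 / r4)"
    unfolding i1 i2 i3 i4 i5 i6 by (simp add: algebra_simps flip: add_divide_distrib)
  moreover have "3 * r1 + 5 * r3 + 55 * r4 + 22 * r6 = 4 * r2 + 75 * r5"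
    unfolding v1 v2 v3 v4 v5 v6 by (simp add: algebra_simps)
  moreover have "2 * r1 * r3 + 3 * r2 * r4 + 9 * r5 * r1 + 9 * r6 * r2 = 27 * r3 * r5 + r4 * r6"
    unfolding v1 v2 v3 v4 v5 v6 by (simp add: field_simps surd)
  ultimately show ?thesis by simp
qed

end
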